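(* Let $n\geq 2$ and $d\geq 1$ be integers with $\gcd(n,d)=1$, let $r$ be an integer, and let $f_0(q),f_1(q),\ldots,f_{n-1}(q)\in\mathbb Z[q]$. For $0\le k\le n-1$ put $$\tilde{f}_k(q)=\sum_{j=0}^k(-1)^jq^{\binom{j}{2}-kj}\begin{bmatrix}k\\ j\end{bmatrix}_q f_j(q).$$ Let $a\in\{0,1,\ldots,n-1\}$ be the unique integer with $ad\equiv -r\pmod n$ (i.e. $a=\langle -r/d\rangle_n$). Then, if $n$ is odd, \begin{align*} &\sum_{k=0}^{n-1} \frac{(q^r;q^d)_k(q^{d-r};q^d)_k}{(q^d;q^d)_k^2}\, f_k(q^d)\\ \equiv\;& (-1)^aq^{d\binom{a+1}2+\frac{(ad+r)(n-1-2a)}{2}}\sum_{k=0}^{n-1}\frac{(q^r;q^d)_k(q^{d-r};q^d)_k}{(q^d;q^d)_k^2}\, \tilde{f}_k(q^d)\pmod{\Phi_n(q)^2}, \end{align*} and, if $n$ is even, \begin{align*} &\sum_{k=0}^{n-1} \frac{(q^r;q^d)_k(q^{d-r};q^d)_k}{(q^d;q^d)_k^2}\, f_k(q^d)\\ \equiv\;& (-1)^{a+\frac{ad+r}{n}}q^{d\binom{a+1}2+\frac{(ad+r)(n-1-2a)}{2}}\sum_{k=0}^{n-1}\frac{(q^r;q^d)_k(q^{d-r};q^d)_k}{(q^d;q^d)_k^2}\, \tilde{f}_k(q^d)\pmod{\Phi_n(q)^2}. \end{align*} Here $\tilde f_k(q^d)$ and $f_k(q^d)$ denote $\tilde f_k$,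 $f_k$ evaluated at $q^d$.
   Context: For $x$ and an integer $n\ge 0$, $(x;q)_n=(1-x)(1-xq)\cdots(1-xq^{n-1})$ for $n\ge1$ and $(x;q)_0=1$. For integers $0\le j\le k$, $\begin{bmatrix}k\\ j\end{bmatrix}_q=\frac{(q;q)_k}{(q;q)_j(q;q)_{k-j}}$ is the Gaussian binomial coefficient. $\Phi_n(q)$ is the $n$-th cyclotomic polynomial. The expressions involved are rational functions in $q$ (Laurent polynomials divided by products of factors $1-q^{dj}$ with $1\le j\le n-1$), whose denominators are coprime to $\Phi_n(q)$; a congruence $A\equiv B\pmod{\Phi_n(q)^2}$ between such rational functions means that $A-B=\Phi_n(q)^2\,P(q)/Q(q)$ with $P,Q\in\mathbb Z[q]$ and $Q$ coprime to $\Phi_n(q)$. Note that $ad+r$ is divisible by $n$, so $\frac{ad+r}{n}$ is an integer, and the exponent $\frac{(ad+r)(n-1-2a)}{2}$ is an integer. *)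

theory Defs
  imports Complex_Main "HOL-Computational_Algebra.Computational_Algebra"
    "HOL-Number_Theory.Number_Theory"
begin

definition cyclotomic :: "nat \<Rightarrow> int poly" where
  "cyclotomic n = (THE p. map_poly (of_int :: int \<Rightarrow> complex) p =
     (\<Prod>k\<in>{k. k < n \<and> coprime k n}. [:- cis (2 * pi * real k / real n), 1:]))"

definition qvar :: "int poly fract" where
  "qvar = to_fract [:0, 1:]"

definition qpoch :: "'a::field \<Rightarrow> 'a \<Rightarrow> nat \<Rightarrow> 'a" where
  "qpoch x y k = (\<Prod>i<k. 1 - x * y ^ i)"

definition qbinom :: "'a::field \<Rightarrow> nat \<Rightarrow> nat \<Rightarrow> 'a" where
  "qbinom z k j = qpoch z z k / (qpoch z z j * qpoch z z (k - j))"

definition peval :: "int poly \<Rightarrow> int poly fract \<Rightarrow> int poly fract" where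
  "peval f z = poly (map_poly (\<lambda>c. to_fract [:c:]) f) z"

definition ftilde :: "(nat \<Rightarrow> int poly) \<Rightarrow> nat \<Rightarrow> int poly fract \<Rightarrow> int poly fract" where
  "ftilde f k z = (\<Sum>j\<le>k. (-1) ^ j * z powi (int (j choose 2) - int k * int j)
                              * qbinom z k j * peval (f j) z)"

definition cong_Phi2 :: "nat \<Rightarrow> int poly fract \<Rightarrow> int poly fract \<Rightarrow> bool" where
  "cong_Phi2 n A B \<longleftrightarrow> (\<exists>P Q. Q \<noteq> 0 \<and> coprime Q (cyclotomic n) \<and>
      A - B = to_fract ((cyclotomic n)\<^sup>2 * P) / to_fract Q)"

end

theory Submission
  imports Defs "HOL-Library.Real_Mod"
begin

text \<open>
  Write y = q^d, ad + r = ns and t = q^(ns), so that q^r = y^(-a) t and q^(d-r) = y / q^r.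
  As functions of t, both sides of the duality are compared through their first-order expansions
  around t = 1. At t = 1 and at t = y^n one of the two q-shifted factorials terminates (at a,
  respectively at n - 1 - a), and there q-Chu-Vandermonde gives the duality exactly, with factors
  (-1)^a y^(-binom(a+1,2)) and (-1)^(n-1-a) y^(-binom(n-a,2)).
  The quotient of these factors is a power of z, where z = q^n for odd n and z = -q^(n/2) for even n;
  t and y^n are powers of z as well. A function of the exponent that is affine modulo
  (z - 1)^2 and vanishes at two points whose distance d is invertible vanishes modulo (z - 1)^2 everywhere, and
  z - 1 is divisible by the cyclotomic polynomial.
\<close>

subsection \<open>The q-Chu-Vandermonde sum\<close>

lemma qpoch_0 [simp]: "qpoch x y 0 = 1"
  by (simp add: qpoch_def)

lemma qpoch_Suc: "qpoch x y (Suc k) = qpoch x y k * (1 - x * y ^ k)"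
  by (simp add: qpoch_def)

lemma qpoch_add: "qpoch x y (m + k) = qpoch x y m * qpoch (x * y ^ m) y k"
  by (induction k) (simp_all add: qpoch_Suc power_add algebra_simps)

lemma qpoch_Suc_left: "qpoch x y (Suc k) = (1 - x) * qpoch (x * y) y k"
  using qpoch_add[of x y 1 k] by (simp add: qpoch_Suc)

lemma qpoch_self_nonzero:
  assumes "\<And>i. 1 \<le> i \<Longrightarrow> i \<le> k \<Longrightarrow> y ^ i \<noteq> 1"
  shows "qpoch y y k \<noteq> 0"
  using assms by (fastforce simp: qpoch_def simp flip: power_Suc)

text \<open>
  The case i = N is excluded: there qbinom z N (Suc N) is not 0, because of truncated subtraction.
\<close>
lemma qbinom_Suc_Suc:
  assumes nz: "qpoch z z (Suc N) \<noteq> 0" and "i < N"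
  shows "qbinom z (Suc N) (Suc i) = qbinom z N (Suc i) + z ^ (N - i) * qbinom z N i"
proof -
  obtain M where N: "N = Suc (i + M)"
    using \<open>i < N\<close> less_imp_Suc_add by blast
  have nz': "qpoch z z k \<noteq> 0" if "k \<le> Suc N" for k
    using nz qpoch_add[of z z k "Suc N - k"] that by auto
  have *: "qpoch z z k \<noteq> 0" "1 - z * z ^ k \<noteq> 0" if "k \<le> N" for k
    using nz'[of k] nz'[of "Suc k"] that by (auto simp: qpoch_Suc)
  have "z * (z * z ^ i * z ^ M) = (z * z ^ M) * (z * z ^ i)"
    by (simp add: algebra_simps)
  then show ?thesis
    using *[of i] *[of M] *[of N] *[of "i + M"]
    by (simp add: N qbinom_def Suc_diff_le qpoch_Suc power_add divide_simps) (simp add: algebra_simps)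
qed

lemma qbinom_0 [simp]: "qpoch z z N \<noteq> 0 \<Longrightarrow> qbinom z N 0 = 1"
  and qbinom_self [simp]: "qpoch z z N \<noteq> 0 \<Longrightarrow> qbinom z N N = 1"
  by (simp_all add: qbinom_def)

lemma choose_2_Suc: "Suc i choose 2 = (i choose 2) + i"
  by (simp add: numeral_2_eq_2)

text \<open>This is the terminating 2phi1 sum with lower parameter c = \<open>y * b\<close>,
  multiplied by \<open>qpoch (y * b) z N\<close> to clear its denominators. The induction keeps
  \<open>b\<close> arbitrary because Pascal's rule shifts it to \<open>b * z\<close>.\<close>

lemma q_Chu_Vandermonde:
  assumes "qpoch z z N \<noteq> 0"
  shows "(\<Sum>i\<le>N. qbinom z N i * (-1) ^ i * z ^ (i choose 2) * y ^ i * qpoch b z i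
            * qpoch (y * b * z ^ i) z (N - i)) = qpoch y z N"
  using assms
proof (induction N arbitrary: b)
  case 0
  then show ?case by (simp add: qbinom_def numeral_2_eq_2)
next
  case (Suc N)
  then have nz: "qpoch z z N \<noteq> 0"
    by (auto simp: qpoch_Suc)
  define t where "t b i = (-1) ^ i * z ^ (i choose 2) * y ^ i * qpoch b z i" for b i
  define P where "P b i M = qpoch (y * b * z ^ i) z M" for b i M
  have IH: "(\<Sum>i\<le>N. qbinom z N i * t b i * P b i (N - i)) = qpoch y z N" for b
    using Suc.IH[OF nz, of b] by (simp add: t_def P_def mult.assoc)
  have P_Suc: "P b i (Suc N - i) = P b i (N - i) * (1 - y * b * z ^ N)" if "i \<le> N" for i b
    using that by (simp add: P_def Suc_diff_le qpoch_Suc mult.assoc flip: power_add)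
  \<comment> \<open>Raising the index splits \<open>1 - b\<close> off
    \<open>qpoch b z (Suc i)\<close> and leaves the term for \<open>b * z\<close>; the powers of
    \<open>z\<close> combine to \<open>z ^ N\<close>, independently of \<open>i\<close>.\<close>
  have t_Suc: "z ^ (N - i) * t b (Suc i) * P b (Suc i) (N - i)
      = - y * z ^ N * (1 - b) * (t (b * z) i * P (b * z) i (N - i))" if "i \<le> N" for i
  proof -
    have "z ^ N = z ^ (N - i) * z ^ i"
      using that by (simp flip: power_add)
    moreover have "P b (Suc i) M = P (b * z) i M" for M
      by (simp add: P_def mult_ac)
    ultimately show ?thesis
      by (simp add: t_def qpoch_Suc_left choose_2_Suc power_add)
  qed
  have "(\<Sum>i\<le>Suc N. qbinom z (Suc N) i * t b i * P b i (Suc N - i))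
      = t b 0 * P b 0 (Suc N) + (\<Sum>i\<le>N. qbinom z (Suc N) (Suc i) * t b (Suc i) * P b (Suc i) (N - i))"
    using Suc.prems by (subst sum.atMost_Suc_shift) simp
  \<comment> \<open>Pascal's rule serves i < N. At i = N the coefficient on the left is 1 and goes
    entirely to the second sum, hence the unequal ranges.\<close>
  also have "(\<Sum>i\<le>N. qbinom z (Suc N) (Suc i) * t b (Suc i) * P b (Suc i) (N - i))
      = (\<Sum>i<N. qbinom z N (Suc i) * t b (Suc i) * P b (Suc i) (N - i))
        + (\<Sum>i\<le>N. z ^ (N - i) * qbinom z N i * t b (Suc i) * P b (Suc i) (N - i))"
    using Suc.prems nz
    by (simp add: lessThan_Suc_atMost[symmetric] qbinom_Suc_Suc algebra_simps sum.distrib)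
  also have "t b 0 * P b 0 (Suc N)
        + ((\<Sum>i<N. qbinom z N (Suc i) * t b (Suc i) * P b (Suc i) (N - i)) + X)
      = (\<Sum>i\<le>N. qbinom z N i * t b i * P b i (Suc N - i)) + X" for X
    unfolding lessThan_Suc_atMost[symmetric] using nz by (subst sum.lessThan_Suc_shift) simp
  also have "(\<Sum>i\<le>N. qbinom z N i * t b i * P b i (Suc N - i)) = (1 - y * b * z ^ N) * qpoch y z N"
    unfolding IH[of b, symmetric] sum_distrib_left by (intro sum.cong) (simp_all add: P_Suc)
  also have "(\<Sum>i\<le>N. z ^ (N - i) * qbinom z N i * t b (Suc i) * P b (Suc i) (N - i))
      = - y * z ^ N * (1 - b) * qpoch y z N"
    unfolding IH[of "b * z", symmetric] sum_distrib_left
  proof (intro sum.cong refl)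
    fix i assume "i \<in> {..N}"
    then show "z ^ (N - i) * qbinom z N i * t b (Suc i) * P b (Suc i) (N - i)
        = - y * z ^ N * (1 - b) * (qbinom z N i * t (b * z) i * P (b * z) i (N - i))"
      using t_Suc[of i] by (simp add: mult_ac)
  qed
  also have "(1 - y * b * z ^ N) * qpoch y z N + - y * z ^ N * (1 - b) * qpoch y z N = qpoch y z (Suc N)"
    by (simp add: qpoch_Suc algebra_simps)
  finally show ?case
    by (simp add: t_def P_def mult.assoc)
qed

text \<open>Each factor is reversed: 1 - z^(i-N) = -z^(i-N) (1 - z^(N-i)). The reversed factors form
  a quotient of two values of \<open>qpoch z z\<close>.\<close>

lemma qpoch_power_neg:
  assumes "z \<noteq> 0" "i \<le> N" "qpoch z z N \<noteq> 0"
  shows "qpoch (z powi (- int N)) z i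
    = (-1) ^ i * z powi (int (i choose 2) - int N * int i) * qpoch z z N / qpoch z z (N - i)"
  using \<open>i \<le> N\<close>
proof (induction i)
  case 0
  then show ?case using assms by (simp add: numeral_2_eq_2)
next
  case (Suc i)
  then obtain M where N: "N = Suc (i + M)"
    using less_imp_Suc_add by (metis Suc_le_eq)
  have nz: "qpoch z z k \<noteq> 0" if "k \<le> N" for k
    using assms(3) qpoch_add[of z z k "N - k"] that by auto
  have nz': "qpoch z z M \<noteq> 0" "1 - z * z ^ M \<noteq> 0"
    using nz[of M] nz[of "Suc M"] by (auto simp: qpoch_Suc N)
  have "1 - z powi (- int N) * z ^ i = - (z powi (int i - int N)) * (1 - z * z ^ M)"
  proof -
    have "z powi (- int N) * z ^ i = z powi (int i - int N)"
      using assms(1) by (simp add: power_int_diff power_int_minus divide_simps)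
    moreover have "z powi (int i - int N) * (z * z ^ M) = 1"
      using assms(1) by (simp add: N power_int_diff power_add)
    ultimately show ?thesis by (simp add: algebra_simps)
  qed
  moreover have "z powi (int (Suc i choose 2) - int N * int (Suc i))
      = z powi (int (i choose 2) - int N * int i) * z powi (int i - int N)"
    using assms(1) by (subst power_int_add[symmetric]) (simp_all add: choose_2_Suc algebra_simps)
  ultimately show ?case
    using Suc nz' by (simp add: qpoch_Suc N Suc_diff_le)
qed

subsection \<open>Duality at a terminating parameter and its first-order deformation\<close>

text \<open>With \<open>y\<close> = q^d and \<open>x\<close> = q^r this is the quotient of q-shifted
  factorials in the theorem. Keeping \<open>x\<close> free allows it to be deformed.\<close>

definition dual_weight :: "'a::field \<Rightarrow> 'a \<Rightarrow> nat \<Rightarrow> 'a" where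
  "dual_weight y x k = qpoch x y k * qpoch (y / x) y k / (qpoch y y k)\<^sup>2"

definition dual_kernel :: "'a::field \<Rightarrow> nat \<Rightarrow> nat \<Rightarrow> 'a" where
  "dual_kernel y k j = (-1) ^ j * y powi (int (j choose 2) - int k * int j) * qbinom y k j"

text \<open>This makes the duality available when the second q-shifted factorial terminates instead
  of the first.\<close>

lemma dual_weight_sym: "y \<noteq> 0 \<Longrightarrow> dual_weight y (y / x) k = dual_weight y x k"
  by (cases "x = 0") (simp_all add: dual_weight_def)

text \<open>Exponent identities are checked below after doubling, where they become polynomial
  identities over the integers.\<close>

lemma double_int_choose_2: "2 * int (m choose 2) = int m * (int m - 1)"
  by (induction m) (simp_all add: choose_2_Suc algebra_simps binomial_eq_0)

lemma qpoch_power_neg_eq_0: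
  assumes "y \<noteq> 0" "a < k"
  shows "qpoch (y powi (- int a)) y k = 0"
  using assms by (auto simp: qpoch_def power_int_minus intro!: bexI[of _ a])

text \<open>At x = y^(-a) the weights form an eigenvector of the transposed kernel. Putting k = j +
  i turns the sum into q-Chu-Vandermonde of length a - j.\<close>

lemma dual_weight_terminating:
  assumes y: "y \<noteq> 0" "qpoch y y a \<noteq> 0" and "a < n"
  shows "(\<Sum>k\<in>{j..<n}. dual_weight y (y powi (- int a)) k * dual_kernel y k j)
    = (-1) ^ a * y powi (- int (Suc a choose 2)) * dual_weight y (y powi (- int a)) j"
proof (cases "j \<le> a")
  case False
  \<comment> \<open>For j > a the right-hand side and every term with k >= j contain the vanishing
    factor of \<open>qpoch x y\<close>, where x = y^(-a).\<close>
  then show ?thesis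
    using y by (simp add: dual_weight_def qpoch_power_neg_eq_0)
next
  case True
  define N where "N = a - j"
  have a: "a = j + N"
    using True by (simp add: N_def)
  define x where "x = y powi (- int a)"
  define g where "g = qpoch y y"
  \<comment> \<open>\<open>b\<close> is the base that remains once the first \<open>j\<close>
    factors are split off \<open>qpoch (y ^ (a + 1)) y (j + i)\<close>.\<close>
  define b where "b = y ^ (a + j + 1)"
  have yx: "y / x = y ^ (a + 1)"
    by (simp add: x_def power_int_minus divide_inverse)
  have g_nz: "g k \<noteq> 0" if "k \<le> a" for k
    using y(2) qpoch_add[of y y k "a - k"] that by (auto simp: g_def)
  \<comment> \<open>\<open>A\<close> collects what does not depend on \<open>i\<close>;
    \<open>V i\<close> is the summand of \<open>q_Chu_Vandermonde\<close> with \<open>x\<close> in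
    the role of \<open>y\<close> there.\<close>
  define A where "A = y powi (- int j - int a * int j) * qpoch (y ^ (a + 1)) y j / (g j * g N)"
  define V where "V i = qbinom y N i * (-1) ^ i * y ^ (i choose 2) * x ^ i * qpoch b y i
      * qpoch (x * b * y ^ i) y (N - i)" for i
  have "(\<Sum>k\<in>{j..<n}. dual_weight y x k * dual_kernel y k j)
      = (\<Sum>k\<in>{j..a}. dual_weight y x k * dual_kernel y k j)"
    using \<open>a < n\<close> y(1) unfolding x_def
    by (intro sum.mono_neutral_right) (auto simp: dual_weight_def qpoch_power_neg_eq_0)
  also have "\<dots> = (\<Sum>i\<le>N. dual_weight y x (j + i) * dual_kernel y (j + i) j)"
    by (rule sum.reindex_bij_witness[of _ "\<lambda>i. j + i" "\<lambda>k. k - j"]) (auto simp: a)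
  also have "\<dots> = (\<Sum>i\<le>N. A * V i)"
  proof (intro sum.cong refl)
    fix i assume "i \<in> {..N}"
    then have i: "i \<le> N" "j + i \<le> a" by (auto simp: a)
    have 1: "qpoch x y (j + i) = (-1) ^ (j + i)
        * y powi (int ((j + i) choose 2) - int a * int (j + i)) * g a / g (N - i)"
      using qpoch_power_neg[OF y(1) i(2) y(2)] by (simp add: x_def g_def N_def)
    have 2: "qpoch (y ^ (a + 1)) y (j + i) = qpoch (y ^ (a + 1)) y j * qpoch b y i"
      using qpoch_add[of "y ^ (a + 1)" y j i] by (simp add: b_def power_add mult_ac)
    have "x * b * y ^ i = y * y ^ (j + i)"
      using y(1) by (simp add: x_def b_def power_int_minus power_add)
    \<comment> \<open>One of the two factors \<open>g (j + i)\<close> in the denominator of the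
      weight is cancelled by the q-binomial; the other completes to \<open>g a\<close> and yields
      the last factor of \<open>V i\<close>.\<close>
    then have 3: "g a = g (j + i) * qpoch (x * b * y ^ i) y (N - i)"
      using qpoch_add[of y y "j + i" "N - i"] i by (simp add: g_def a)
    have "2 * (int ((j + i) choose 2) - int a * int (j + i) + (int (j choose 2) - int (j + i) * int j))
        = 2 * (- int j - int a * int j + int (i choose 2) - int a * int i)"
      unfolding right_diff_distrib distrib_left double_int_choose_2 by (simp add: algebra_simps)
    then have e: "int ((j + i) choose 2) - int a * int (j + i) + (int (j choose 2) - int (j + i) * int j)
        = - int j - int a * int j + int (i choose 2) - int a * int i"
      by simp
    have "x ^ i = y powi (- (int a * int i))"
      unfolding x_def by (metis mult_minus_left power_int_mult power_int_of_nat)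
    then have 4: "y powi (int ((j + i) choose 2) - int a * int (j + i))
          * y powi (int (j choose 2) - int (j + i) * int j)
        = y powi (- int j - int a * int j) * (y ^ (i choose 2) * x ^ i)"
      using y(1) by (subst power_int_add[symmetric], simp, subst e)
        (simp add: power_int_add power_int_diff power_int_minus divide_inverse)
    have nz: "g (j + i) \<noteq> 0" "g (N - i) \<noteq> 0" "g j \<noteq> 0" "g i \<noteq> 0" "g N \<noteq> 0" "g a \<noteq> 0"
      using i by (auto intro!: g_nz simp: a)
    have sgn: "(-1::'a) ^ (j + i) * (-1) ^ j = (-1) ^ i"
      by (simp add: power_add mult.assoc mult.left_commute)
    have "dual_weight y x (j + i) * dual_kernel y (j + i) j
      = ((-1) ^ (j + i) * (-1) ^ j) * (y powi (int ((j + i) choose 2) - int a * int (j + i))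
          * y powi (int (j choose 2) - int (j + i) * int j))
        * (g a / g (N - i) * (qpoch (y ^ (a + 1)) y j * qpoch b y i) / (g (j + i))\<^sup>2
           * (g (j + i) / (g j * g i)))"
      unfolding dual_weight_def dual_kernel_def qbinom_def yx 1 2 g_def[symmetric] by (simp add: mult_ac)
    also have "\<dots> = A * V i"
      unfolding sgn 4 V_def A_def qbinom_def g_def[symmetric] 3 using nz
      by (simp add: power2_eq_square field_simps)
    finally show "dual_weight y x (j + i) * dual_kernel y (j + i) j = A * V i" .
  qed
  also have "\<dots> = A * qpoch x y N"
    unfolding sum_distrib_left[symmetric] V_def
    by (subst q_Chu_Vandermonde) (use g_nz[of N] in \<open>simp_all add: g_def a\<close>)
  also have "qpoch x y N = (-1) ^ N * y powi (int (N choose 2) - int a * int N) * g a / g j"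
    using qpoch_power_neg[of y N a] y by (simp add: x_def g_def a)
  \<comment> \<open>It remains to write the first factorial of the weight at \<open>j\<close>
    through \<open>qpoch_power_neg\<close> as well and to compare powers of
    \<open>y\<close>.\<close>
  also have "A * ((-1) ^ N * y powi (int (N choose 2) - int a * int N) * g a / g j)
      = (-1) ^ a * y powi (- int (Suc a choose 2)) * dual_weight y x j"
  proof -
    have "2 * (- int j - int a * int j + (int (N choose 2) - int a * int N))
        = 2 * (- int (Suc a choose 2) + (int (j choose 2) - int a * int j))"
      unfolding right_diff_distrib distrib_left double_int_choose_2 mult_minus_right
      by (simp add: a algebra_simps)
    then have "- int j - int a * int j + (int (N choose 2) - int a * int N)
        = - int (Suc a choose 2) + (int (j choose 2) - int a * int j)"
      unfolding mult_cancel_left by simp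
    then have e: "y powi (- int j - int a * int j) * y powi (int (N choose 2) - int a * int N)
        = y powi (- int (Suc a choose 2)) * y powi (int (j choose 2) - int a * int j)"
      using y(1) by (metis power_int_add)
    have u: "dual_weight y x j = (-1) ^ j * y powi (int (j choose 2) - int a * int j) * g a / g N
        * qpoch (y ^ (a + 1)) y j / (g j)\<^sup>2"
      using qpoch_power_neg[OF y(1) True y(2)] unfolding dual_weight_def yx
      by (simp add: x_def g_def N_def)
    have "(-1::'a) ^ N = (-1) ^ a * (-1) ^ j"
      by (simp add: a power_add mult.left_commute)
    then have "A * ((-1) ^ N * y powi (int (N choose 2) - int a * int N) * g a / g j)
      = (-1) ^ a * (-1) ^ j * (y powi (- int j - int a * int j) * y powi (int (N choose 2) - int a * int N))
        * qpoch (y ^ (a + 1)) y j * g a / (g N * (g j)\<^sup>2)"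
      by (simp add: A_def power2_eq_square divide_inverse mult_ac)
    then show ?thesis
      unfolding e u by simp
  qed
  finally show ?thesis
    by (simp add: x_def)
qed

section \<open>Functions of an integer that are affine modulo a square\<close>

locale field_subring =
  fixes R :: "'a::field set"
  assumes one_closed [simp, intro]: "1 \<in> R"
    and diff_closed [simp, intro]: "x \<in> R \<Longrightarrow> y \<in> R \<Longrightarrow> x - y \<in> R"
    and mult_closed [simp, intro]: "x \<in> R \<Longrightarrow> y \<in> R \<Longrightarrow> x * y \<in> R"
begin

lemma zero_closed [simp, intro]: "0 \<in> R"
  using diff_closed[of 1 1] by simp

lemma uminus_closed [simp, intro]: "x \<in> R \<Longrightarrow> - x \<in> R"
  using diff_closed[of 0 x] by simp

lemma add_closed [simp, intro]: "x \<in> R \<Longrightarrow> y \<in> R \<Longrightarrow> x + y \<in> R"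
  using diff_closed[of x "- y"] by simp

lemma power_closed [simp, intro]: "x \<in> R \<Longrightarrow> x ^ k \<in> R"
  by (induction k) auto

lemma of_nat_closed [simp, intro]: "of_nat k \<in> R"
  by (induction k) auto

lemma of_int_closed [simp, intro]: "of_int k \<in> R"
  by (cases k rule: int_cases2) auto

lemma sum_closed [intro]: "(\<And>i. i \<in> A \<Longrightarrow> f i \<in> R) \<Longrightarrow> sum f A \<in> R"
  by (induction A rule: infinite_finite_induct) auto

lemma prod_closed [intro]: "(\<And>i. i \<in> A \<Longrightarrow> f i \<in> R) \<Longrightarrow> prod f A \<in> R"
  by (induction A rule: infinite_finite_induct) auto

lemma power_int_closed [intro]: "x \<in> R \<Longrightarrow> inverse x \<in> R \<Longrightarrow> x powi k \<in> R"
  by (auto simp: power_int_def)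

text \<open>A first-order expansion at w = 0: \<open>c\<close> and \<open>D\<close> are chosen
  before \<open>l\<close>, whereas the remainder \<open>e\<close> may depend on
  \<open>l\<close>.\<close>

definition affine_mod :: "'a \<Rightarrow> (int \<Rightarrow> 'a) \<Rightarrow> bool" where
  "affine_mod w g \<longleftrightarrow> (\<exists>c\<in>R. \<exists>D\<in>R. \<forall>l. \<exists>e\<in>R. g l = c + of_int l * w * D + w\<^sup>2 * e)"

lemma affine_mod_const: "c \<in> R \<Longrightarrow> affine_mod w (\<lambda>_. c)"
  unfolding affine_mod_def by (rule bexI[of _ c], rule bexI[of _ 0]) (auto intro!: bexI[of _ 0])

lemma affine_mod_diff:
  assumes "affine_mod w g" "affine_mod w h"
  shows "affine_mod w (\<lambda>l. g l - h l)"
proof -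
  obtain c D where *: "c \<in> R" "D \<in> R" "\<And>l. \<exists>e\<in>R. g l = c + of_int l * w * D + w\<^sup>2 * e"
    using assms unfolding affine_mod_def by blast
  obtain c' D' where **: "c' \<in> R" "D' \<in> R" "\<And>l. \<exists>e\<in>R. h l = c' + of_int l * w * D' + w\<^sup>2 * e"
    using assms unfolding affine_mod_def by blast
  have "\<exists>e\<in>R. g l - h l = (c - c') + of_int l * w * (D - D') + w\<^sup>2 * e" for l
  proof -
    obtain e e' where "e \<in> R" "g l = c + of_int l * w * D + w\<^sup>2 * e"
      "e' \<in> R" "h l = c' + of_int l * w * D' + w\<^sup>2 * e'"
      using *(3) **(3) by meson
    then show ?thesis
      by (intro bexI[of _ "e - e'"]) (auto simp: algebra_simps)
  qed
  with * ** show ?thesis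
    unfolding affine_mod_def by blast
qed

lemma affine_mod_add: "affine_mod w g \<Longrightarrow> affine_mod w h \<Longrightarrow> affine_mod w (\<lambda>l. g l + h l)"
  using affine_mod_diff[of w g "\<lambda>l. 0 - h l"] affine_mod_diff[of w "\<lambda>_. 0" h]
  by (auto simp: affine_mod_const)

lemma affine_mod_sum:
  "(\<And>i. i \<in> A \<Longrightarrow> affine_mod w (g i)) \<Longrightarrow> affine_mod w (\<lambda>l. \<Sum>i\<in>A. g i l)"
  by (induction A rule: infinite_finite_induct) (auto intro: affine_mod_const affine_mod_add)

text \<open>The product of the two linear terms is quadratic in \<open>l\<close>, but it carries w^2
  and is absorbed by the remainder.\<close>

lemma affine_mod_mult:
  assumes "w \<in> R" "affine_mod w g" "affine_mod w h"
  shows "affine_mod w (\<lambda>l. g l * h l)"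
proof -
  obtain c D where *: "c \<in> R" "D \<in> R" "\<And>l. \<exists>e\<in>R. g l = c + of_int l * w * D + w\<^sup>2 * e"
    using assms unfolding affine_mod_def by blast
  obtain c' D' where **: "c' \<in> R" "D' \<in> R" "\<And>l. \<exists>e\<in>R. h l = c' + of_int l * w * D' + w\<^sup>2 * e"
    using assms unfolding affine_mod_def by blast
  have "\<exists>e\<in>R. g l * h l = c * c' + of_int l * w * (c * D' + c' * D) + w\<^sup>2 * e" for l
  proof -
    obtain e e' where e: "e \<in> R" "g l = c + of_int l * w * D + w\<^sup>2 * e"
      "e' \<in> R" "h l = c' + of_int l * w * D' + w\<^sup>2 * e'"
      using *(3) **(3) by meson
    show ?thesis
    proof (intro bexI)
      show "g l * h l = c * c' + of_int l * w * (c * D' + c' * D)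
          + w\<^sup>2 * ((of_int l)\<^sup>2 * D * D' + e * h l + e' * (c + of_int l * w * D))"
        unfolding e by (simp add: algebra_simps power2_eq_square)
    qed (use assms(1) * ** e in \<open>auto\<close>)
  qed
  with * ** show ?thesis
    unfolding affine_mod_def by blast
qed

lemma affine_mod_prod:
  "w \<in> R \<Longrightarrow> (\<And>i. i \<in> A \<Longrightarrow> affine_mod w (g i)) \<Longrightarrow> affine_mod w (\<lambda>l. \<Prod>i\<in>A. g i l)"
  by (induction A rule: infinite_finite_induct) (auto intro: affine_mod_const affine_mod_mult)

text \<open>This is the binomial expansion of (1 + w)^l with w = z - 1. Negative exponents are
  covered because \<open>inverse z\<close> lies in \<open>R\<close>.\<close>

lemma affine_mod_power_int:
  assumes z: "z \<in> R" "inverse z \<in> R" "z \<noteq> 0"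
  shows "affine_mod (z - 1) (\<lambda>l. z powi (k * l))"
proof -
  have *: "\<exists>e\<in>R. z powi l = 1 + of_int l * (z - 1) + (z - 1)\<^sup>2 * e" for l
  proof (induction l rule: int_induct[of _ 0])
    case base
    show ?case by (auto intro!: bexI[of _ 0])
  next
    case (step1 l)
    then obtain e where e: "e \<in> R" "z powi l = 1 + of_int l * (z - 1) + (z - 1)\<^sup>2 * e" by blast
    have "z powi (l + 1) = (1 + of_int l * (z - 1) + (z - 1)\<^sup>2 * e) * z"
      using z e by (simp add: power_int_add)
    then show ?case
      using z e by (intro bexI[of _ "of_int l + e * z"]) (auto simp: algebra_simps power2_eq_square)
  next
    case (step2 l)
    then obtain e where e: "e \<in> R" "z powi l = 1 + of_int l * (z - 1) + (z - 1)\<^sup>2 * e" by blast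
    have "z powi (l - 1) = (1 + of_int l * (z - 1) + (z - 1)\<^sup>2 * e) / z"
      using z e by (simp add: power_int_diff)
    \<comment> \<open>The new remainder comes from 1 + l w - (1 + (l-1) w)(1 + w) = -(l-1)
      w^2.\<close>
    then have "z powi (l - 1)
        = 1 + of_int (l - 1) * (z - 1) + (z - 1)\<^sup>2 * ((e - of_int (l - 1)) * inverse z)"
      using z(3) by (simp add: divide_simps) (simp add: algebra_simps power2_eq_square)
    moreover have "(e - of_int (l - 1)) * inverse z \<in> R"
      using z(2) e(1) by blast
    ultimately show ?case by blast
  qed
  have "\<exists>e\<in>R. z powi (k * l) = 1 + of_int l * (z - 1) * of_int k + (z - 1)\<^sup>2 * e" for l
    using *[of "k * l"] by (simp add: mult_ac)
  then show ?thesis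
    unfolding affine_mod_def by (intro bexI[of _ 1] bexI[of _ "of_int k"]) auto
qed

text \<open>The zero at 0 puts \<open>c\<close> into w^2 R; the zero at \<open>d\<close> then puts d
  w D there, and invertibility of \<open>d\<close> gives w D itself.\<close>

lemma affine_mod_eq_0:
  assumes "affine_mod w g" "g 0 = 0" "g d = 0" "inverse (of_int d) \<in> R" "(of_int d :: 'a) \<noteq> 0"
  shows "\<exists>e\<in>R. g s = w\<^sup>2 * e"
proof -
  obtain c D where *: "c \<in> R" "D \<in> R" "\<And>l. \<exists>e\<in>R. g l = c + of_int l * w * D + w\<^sup>2 * e"
    using assms unfolding affine_mod_def by blast
  obtain e0 where e0: "e0 \<in> R" "g 0 = c + of_int 0 * w * D + w\<^sup>2 * e0" using *(3) by blast
  obtain e1 where e1: "e1 \<in> R" "g d = c + of_int d * w * D + w\<^sup>2 * e1" using *(3) by blast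
  obtain e2 where e2: "e2 \<in> R" "g s = c + of_int s * w * D + w\<^sup>2 * e2" using *(3) by blast
  have c: "c = - w\<^sup>2 * e0"
    using e0 assms(2) by (simp add: eq_neg_iff_add_eq_0)
  have "of_int d * w * D = w\<^sup>2 * (e0 - e1)"
    using e1 assms(3) c by (simp add: algebra_simps add_eq_0_iff)
  then have "w * D = w\<^sup>2 * ((e0 - e1) * inverse (of_int d))"
    using assms(5) by (simp add: field_simps)
  then have "of_int s * w * D = w\<^sup>2 * (of_int s * ((e0 - e1) * inverse (of_int d)))"
    by (simp add: mult_ac)
  then have "g s = w\<^sup>2 * (- e0 + of_int s * ((e0 - e1) * inverse (of_int d)) + e2)"
    unfolding e2(2) c by (simp add: algebra_simps)
  then show ?thesis
    using assms e0 e1 e2 by blast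
qed

text \<open>The integer \<open>s\<close> is replaced by a variable \<open>l\<close>. The difference
  of the two sides is affine modulo (z - 1)^2 and vanishes at l = 0 and l = d; the power z^(m l) in
  the prefactor interpolates between the two eigenvalues.\<close>

lemma dual_sum_congruence:
  fixes n a d e :: nat and m s :: int
  assumes y: "y \<in> R" "inverse y \<in> R" "y \<noteq> 0" and z: "z \<in> R" "inverse z \<in> R" "z \<noteq> 0"
    and unit: "\<And>i. 1 \<le> i \<Longrightarrow> i < n \<Longrightarrow> y ^ i \<noteq> 1 \<and> inverse (1 - y ^ i) \<in> R"
    and d: "inverse (of_nat d) \<in> R" "(of_nat d :: 'a) \<noteq> 0"
    and "a < n"
    and yn: "y ^ n = z ^ (e * d)"
    and sgn: "(-1) ^ (n - 1 - a) * y powi (- int ((n - a) choose 2))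
      = (-1) ^ a * y powi (- int (Suc a choose 2)) * z powi (- (m * int d))"
    and F: "\<And>k. k < n \<Longrightarrow> F k \<in> R"
    and x: "x = y powi (- int a) * z powi (int e * s)"
  shows "\<exists>r\<in>R. (\<Sum>k<n. dual_weight y x k * F k)
     - (-1) ^ a * y powi (int (Suc a choose 2)) * z powi (m * s)
       * (\<Sum>k<n. dual_weight y x k * (\<Sum>j\<le>k. dual_kernel y k j * F j)) = (z - 1)\<^sup>2 * r"
proof -
  define X where "X l = y powi (- int a) * z powi (int e * l)" for l
  define T where "T x = (\<Sum>k<n. dual_weight y x k * (\<Sum>j\<le>k. dual_kernel y k j * F j))" for x
  define H where "H l = (\<Sum>k<n. dual_weight y (X l) k * F k)
     - (-1) ^ a * y powi (int (Suc a choose 2)) * z powi (m * l) * T (X l)" for l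
  have nz: "qpoch y y k \<noteq> 0" if "k < n" for k
    using unit that by (intro qpoch_self_nonzero) auto
  \<comment> \<open>Exchanging the summations over j <= k < n exposes, for each \<open>j\<close>,
    the sum evaluated by \<open>dual_weight_terminating\<close>.\<close>
  have T_eq: "T (y powi (- int b)) = (-1) ^ b * y powi (- int (Suc b choose 2))
      * (\<Sum>k<n. dual_weight y (y powi (- int b)) k * F k)" if "b < n" for b
  proof -
    have "T (y powi (- int b))
        = (\<Sum>j<n. (\<Sum>k\<in>{j..<n}. dual_weight y (y powi (- int b)) k * dual_kernel y k j) * F j)"
      unfolding T_def sum_distrib_left sum_distrib_right
      by (subst sum.Sigma, simp, simp, subst sum.Sigma, simp, simp,
          rule sum.reindex_bij_witness[of _ "\<lambda>(j, k). (k, j)" "\<lambda>(k, j). (j, k)"])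
        (auto simp: mult_ac)
    also have "\<dots> = (\<Sum>j<n. (-1) ^ b * y powi (- int (Suc b choose 2))
        * dual_weight y (y powi (- int b)) j * F j)"
      using that y nz by (simp add: dual_weight_terminating)
    finally show ?thesis
      by (simp add: sum_distrib_left mult.assoc)
  qed
  have sgn_sq: "(-1) ^ a * y powi c * ((-1) ^ a * y powi (- c)) = 1" for c
  proof -
    have "(-1) ^ a * y powi c * ((-1) ^ a * y powi (- c)) = ((-1) * (-1)) ^ a * (y powi c * y powi (- c))"
      by (simp only: power_mult_distrib mult_ac)
    then show ?thesis
      using y(3) by (simp add: power_int_minus)
  qed
  have "affine_mod (z - 1) H"
  proof -
    have w: "z - 1 \<in> R" using z by simp
    \<comment> \<open>Every factor of both numerator factorials has this shape, with c = y^(-a), k =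
      e or c = y^(a+1), k = -e.\<close>
    have lin: "affine_mod (z - 1) (\<lambda>l. 1 - c * z powi (k * l) * y ^ i)" if "c \<in> R" for c k i
      using that w y z
      by (intro affine_mod_diff affine_mod_mult affine_mod_power_int affine_mod_const) auto
    have inv: "inverse (qpoch y y k) \<in> R" if "k < n" for k
      using that unit[of "Suc i" for i]
      by (auto simp: qpoch_def prod_inversef[symmetric] o_def intro!: prod_closed)
    have "qpoch y y k \<in> R" for k
      using y by (auto simp: qpoch_def)
    then have qb: "qbinom y k j \<in> R" if "j \<le> k" "k < n" for k j
      using that inv[of j] inv[of "k - j"] by (simp add: qbinom_def divide_inverse)
    have kernel: "dual_kernel y k j \<in> R" if "j \<le> k" "k < n" for k j
      unfolding dual_kernel_def using y qb[OF that]
      by (intro mult_closed power_closed uminus_closed one_closed power_int_closed)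
    have weight: "affine_mod (z - 1) (\<lambda>l. dual_weight y (X l) k)" if "k < n" for k
    proof -
      have "y / X l = y powi (int a + 1) * z powi (- int e * l)" for l
        using y z by (simp add: X_def power_int_minus power_int_add field_simps)
      then have "(\<lambda>l. dual_weight y (X l) k)
        = (\<lambda>l. (\<Prod>i<k. 1 - y powi (- int a) * z powi (int e * l) * y ^ i)
            * (\<Prod>i<k. 1 - y powi (int a + 1) * z powi (- int e * l) * y ^ i)
            * (inverse (qpoch y y k))\<^sup>2)"
        by (simp add: dual_weight_def X_def qpoch_def divide_inverse power_inverse)
      moreover have "affine_mod (z - 1) (\<lambda>l. (\<Prod>i<k. 1 - y powi (- int a) * z powi (int e * l) * y ^ i)
            * (\<Prod>i<k. 1 - y powi (int a + 1) * z powi (- int e * l) * y ^ i)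
            * (inverse (qpoch y y k))\<^sup>2)"
        using w y z inv[OF that]
        by (intro affine_mod_mult affine_mod_prod lin affine_mod_const power_int_closed) auto
      ultimately show ?thesis by simp
    qed
    show ?thesis
      unfolding H_def T_def
      using w y z F
      by (intro affine_mod_diff affine_mod_sum affine_mod_mult weight affine_mod_power_int
          affine_mod_const mult_closed power_int_closed sum_closed kernel) auto
  qed
  moreover have "H 0 = 0"
    using sgn_sq[of "int (Suc a choose 2)"]
    by (simp add: H_def X_def T_eq[OF \<open>a < n\<close>] mult.assoc[symmetric])
  moreover have "H (int d) = 0"
  proof -
    \<comment> \<open>At l = d the parameter is y^(n-a) = y / y^(-b), so the symmetry of the weight
      leads to the terminating parameter for \<open>b\<close>.\<close>
    define b where "b = n - 1 - a"
    have b: "b < n" "n = Suc (a + b)" "Suc b = n - a"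
      using \<open>a < n\<close> by (auto simp: b_def)
    have "z powi (int e * int d) = y powi int n"
      using yn by (metis of_nat_mult power_int_of_nat)
    then have "X (int d) = y powi (int b + 1)"
      using y by (simp add: X_def b(2) flip: power_int_add) (simp add: algebra_simps)
    then have "X (int d) = y / (y powi (- int b))"
      using y by (simp add: power_int_add power_int_minus divide_inverse)
    then have W: "dual_weight y (X (int d)) = dual_weight y (y powi (- int b))"
      using y by (simp add: dual_weight_sym fun_eq_iff)
    have "T (X (int d)) = T (y powi (- int b))"
      by (simp add: T_def W)
    also have "\<dots> = (-1) ^ a * y powi (- int (Suc a choose 2)) * z powi (- (m * int d))
      * (\<Sum>k<n. dual_weight y (X (int d)) k * F k)"
      \<comment> \<open>The hypothesis \<open>sgn\<close> expresses the eigenvalue for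
        \<open>b\<close> as that for \<open>a\<close> times z^(-m d), which the prefactor at l = d
        cancels.\<close>
      using T_eq[OF b(1)] sgn by (simp add: W b(3)) (simp add: b_def)
    finally have "(-1) ^ a * y powi (int (Suc a choose 2)) * z powi (m * int d) * T (X (int d))
      = ((-1) ^ a * y powi (int (Suc a choose 2)) * ((-1) ^ a * y powi (- int (Suc a choose 2))))
        * (z powi (m * int d) * z powi (- (m * int d))) * (\<Sum>k<n. dual_weight y (X (int d)) k * F k)"
      by (simp only: mult_ac)
    then show ?thesis
      unfolding sgn_sq using z(3) by (simp add: H_def power_int_minus)
  qed
  ultimately show ?thesis
    using affine_mod_eq_0[of "z - 1" H "int d" s] d by (simp add: H_def X_def T_def x)
qed

end

subsection \<open>Cyclotomic polynomials\<close>

abbreviation cpoly :: "int poly \<Rightarrow> complex poly" where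
  "cpoly \<equiv> map_poly of_int"

lemma cpoly_add [simp]: "cpoly (p + q) = cpoly p + cpoly q"
  and cpoly_diff [simp]: "cpoly (p - q) = cpoly p - cpoly q"
  by (simp_all add: poly_eq_iff coeff_map_poly)

lemma cpoly_mult [simp]: "cpoly (p * q) = cpoly p * cpoly q"
  by (simp add: poly_eq_iff coeff_map_poly coeff_mult)

lemma cpoly_prod [simp]: "cpoly (\<Prod>i\<in>A. f i) = (\<Prod>i\<in>A. cpoly (f i))"
  by (induction A rule: infinite_finite_induct) simp_all

lemma cpoly_monom [simp]: "cpoly (Polynomial.monom c k) = Polynomial.monom (of_int c) k"
  by (simp add: map_poly_monom)

lemma cpoly_eq_iff [simp]: "cpoly p = cpoly q \<longleftrightarrow> p = q"
  by (simp add: poly_eq_iff coeff_map_poly)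

lemma degree_cpoly [simp]: "degree (cpoly p) = degree p"
  by (simp add: degree_map_poly)

lemma cpoly_eq_0_iff [simp]: "cpoly p = 0 \<longleftrightarrow> p = 0"
  using cpoly_eq_iff[of p 0] by (simp del: cpoly_eq_iff)

lemma cpoly_linear_factors:
  fixes A :: "complex set"
  assumes "cpoly p = (\<Prod>x\<in>A. [:- x, 1:])"
  shows "lead_coeff p = 1" and "degree p = card A"
proof -
  have "lead_coeff (cpoly p) = 1"
    unfolding assms lead_coeff_prod by simp
  then show "lead_coeff p = 1"
    by (simp add: coeff_map_poly)
  show "degree p = card A"
    unfolding degree_cpoly[symmetric] assms by (subst degree_prod_eq_sum_degree) auto
qed

text \<open>Since \<open>p\<close> is monic, division with remainder stays over the integers. The
  remainder has degree below \<open>card A\<close> yet vanishes on all of \<open>A\<close>, so it is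
  zero.\<close>

lemma dvd_if_vanishes_on_roots:
  fixes A :: "complex set"
  assumes p: "cpoly p = (\<Prod>x\<in>A. [:- x, 1:])" and "finite A"
    and f: "\<And>x. x \<in> A \<Longrightarrow> poly (cpoly f) x = 0"
  shows "p dvd f"
proof -
  note lc = cpoly_linear_factors[OF p]
  \<comment> \<open>Pseudo-division multiplies \<open>f\<close> by a power of the leading
    coefficient, which is 1 here.\<close>
  obtain q r where qr: "pseudo_divmod f p = (q, r)" by force
  have "p \<noteq> 0" using lc by auto
  from pseudo_divmod[OF this qr] lc have f_eq: "f = p * q + r" and r: "r = 0 \<or> degree r < card A"
    by simp_all
  have "r = 0"
  proof (rule ccontr)
    assume "r \<noteq> 0"
    have "A \<subseteq> {x. poly (cpoly r) x = 0}"
    proof safe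
      fix x assume "x \<in> A"
      then have "poly (cpoly p) x = 0"
        using \<open>finite A\<close> by (auto simp: p poly_prod)
      then show "poly (cpoly r) x = 0"
        using f[OF \<open>x \<in> A\<close>] by (simp add: f_eq)
    qed
    then have "card A \<le> card {x. poly (cpoly r) x = 0}"
      using \<open>r \<noteq> 0\<close> by (intro card_mono poly_roots_finite) simp_all
    also have "\<dots> \<le> degree r"
      using card_poly_roots_bound[of "cpoly r"] \<open>r \<noteq> 0\<close> by simp
    finally show False
      using r \<open>r \<noteq> 0\<close> by simp
  qed
  then show ?thesis
    using f_eq by simp
qed

text \<open>Described by exact order rather than by angle, so that sorting roots of unity by order
  is immediate.\<close>

definition primitive_roots :: "nat \<Rightarrow> complex set" where
  "primitive_roots n = {x. x ^ n = 1 \<and> (\<forall>m. 0 < m \<longrightarrow> m < n \<longrightarrow> x ^ m \<noteq> 1)}"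

lemma cis_root_power_eq_1_iff:
  assumes "n > 0"
  shows "cis (2 * pi * real k / real n) ^ m = 1 \<longleftrightarrow> n dvd k * m"
proof
  assume "cis (2 * pi * real k / real n) ^ m = 1"
  then obtain j where "real m * (2 * pi * real k / real n) = of_int j * (2 * pi)"
    by (auto simp: Complex.DeMoivre cis_eq_1_iff)
  then have "real_of_int (int (k * m)) = real_of_int (j * int n)"
    using assms by (simp add: field_simps)
  then have "int (k * m) = j * int n"
    by (simp only: of_int_eq_iff)
  then show "n dvd k * m"
    by (metis dvd_triv_right int_dvd_int_iff)
next
  assume "n dvd k * m"
  then obtain j where "k * m = n * j" by (auto elim: dvdE)
  then have "real m * real k = real n * real j"
    by (metis mult.commute of_nat_mult)
  then have "real m * (2 * pi * real k / real n) = of_int (int j) * (2 * pi)"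
    using assms by (simp add: field_simps)
  then show "cis (2 * pi * real k / real n) ^ m = 1"
    unfolding Complex.DeMoivre cis_eq_1_iff by blast
qed

text \<open>This connects the index set in \<open>cyclotomic\<close> with exact order: if g = gcd(k,
  n), the power n/g is already 1, so order n forces g = 1.\<close>

lemma bij_betw_primitive_roots:
  assumes "n > 0"
  shows "bij_betw (\<lambda>k. cis (2 * pi * real k / real n)) {k. k < n \<and> coprime k n} (primitive_roots n)"
proof -
  let ?c = "\<lambda>k. cis (2 * pi * real k / real n)"
  have prim: "?c k \<in> primitive_roots n \<longleftrightarrow> coprime k n" for k
  proof
    assume c: "?c k \<in> primitive_roots n"
    define g where "g = gcd k n"
    have g: "g dvd k" "g dvd n" "g > 0"
      using assms by (simp_all add: g_def)
    then obtain k' n' where kn: "k = g * k'" "n = g * n'"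
      by (elim dvdE)
    then have "n dvd k * n'" by simp
    then have "?c k ^ n' = 1"
      using cis_root_power_eq_1_iff[OF assms] by blast
    moreover have "0 < n'"
      using assms kn by simp
    ultimately have "\<not> n' < n"
      using c by (auto simp: primitive_roots_def)
    then have "g = 1"
      using \<open>0 < n'\<close> \<open>g > 0\<close> unfolding kn(2) by (cases "g = 1") auto
    then show "coprime k n"
      by (simp only: g_def coprime_iff_gcd_eq_1)
  next
    assume "coprime k n"
    then have "coprime n k"
      by (subst coprime_commute)
    then have "n dvd k * m \<longleftrightarrow> n dvd m" for m
      by (rule coprime_dvd_mult_right_iff)
    then show "?c k \<in> primitive_roots n"
      using assms by (simp add: primitive_roots_def cis_root_power_eq_1_iff nat_dvd_not_less)
  qed
  have inj: "inj_on ?c {..<n}" and img: "?c ` {..<n} = {x. x ^ n = 1}"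
    using bij_betw_roots_unity[OF assms] unfolding bij_betw_def by blast+
  show ?thesis
    unfolding bij_betw_def
  proof
    show "inj_on ?c {k. k < n \<and> coprime k n}"
      by (rule inj_on_subset[OF inj]) blast
    have "primitive_roots n = {x \<in> ?c ` {..<n}. x \<in> primitive_roots n}"
      unfolding img primitive_roots_def by blast
    also have "\<dots> = ?c ` {k. k < n \<and> coprime k n}"
      using prim by blast
    finally show "?c ` {k. k < n \<and> coprime k n} = primitive_roots n" ..
  qed
qed

lemma primitive_root_power_eq_1_iff:
  assumes "x \<in> primitive_roots n" "n > 0"
  shows "x ^ m = 1 \<longleftrightarrow> n dvd m"
proof -
  obtain k where "coprime k n" "x = cis (2 * pi * real k / real n)"
    using bij_betw_primitive_roots[OF \<open>n > 0\<close>] assms(1) unfolding bij_betw_def by blast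
  then show ?thesis
    using \<open>n > 0\<close> coprime_dvd_mult_right_iff[of n k m] coprime_commute[of n k]
    by (simp only: cis_root_power_eq_1_iff)
qed

lemma finite_primitive_roots: "n > 0 \<Longrightarrow> finite (primitive_roots n)"
  using bij_betw_finite[OF bij_betw_primitive_roots] by simp

text \<open>The order of x is the least positive exponent d with x^d = 1; the remainder of n modulo
  d is a smaller such exponent unless it is 0.\<close>

lemma roots_unity_eq_Union:
  assumes "n > 0"
  shows "{x::complex. x ^ n = 1} = (\<Union>d\<in>{d. d dvd n}. primitive_roots d)"
proof (intro Set.set_eqI iffI)
  fix x :: complex assume "x \<in> {x. x ^ n = 1}"
  then have x: "x ^ n = 1" by simp
  define d where "d = (LEAST m. 0 < m \<and> x ^ m = 1)"
  have d: "0 < d \<and> x ^ d = 1"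
    unfolding d_def by (rule LeastI[of _ n]) (use assms x in auto)
  have min: "x ^ m \<noteq> 1" if "0 < m" "m < d" for m
    using not_less_Least[of m "\<lambda>m. 0 < m \<and> x ^ m = 1"] that by (auto simp: d_def)
  have "x ^ (d * (n div d) + n mod d) = 1" using x by simp
  then have "x ^ (n mod d) = 1" using d by (simp only: power_add power_mult) simp
  then have "n mod d = 0" using min[of "n mod d"] d by auto
  then show "x \<in> (\<Union>d\<in>{d. d dvd n}. primitive_roots d)"
    using d min by (auto simp: primitive_roots_def)
next
  fix x :: complex assume "x \<in> (\<Union>d\<in>{d. d dvd n}. primitive_roots d)"
  then show "x \<in> {x. x ^ n = 1}"
    by (auto simp: primitive_roots_def power_mult elim!: dvdE)
qed

lemma primitive_roots_disjoint:
  assumes "0 < m" "0 < n" "m \<noteq> n"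
  shows "primitive_roots m \<inter> primitive_roots n = {}"
proof (rule ccontr)
  assume "primitive_roots m \<inter> primitive_roots n \<noteq> {}"
  then obtain x where x: "x \<in> primitive_roots m" "x \<in> primitive_roots n" by blast
  then have "x ^ m = 1" "x ^ n = 1"
    by (simp_all add: primitive_roots_def)
  with x assms show False
    by (metis dvd_antisym primitive_root_power_eq_1_iff)
qed

text \<open>The derivative n x^(n-1) vanishes at most at 0, which is not a root, so all roots are
  simple.\<close>

lemma monom_minus_1_eq_prod:
  assumes "n > 0"
  shows "Polynomial.monom 1 n - 1 = (\<Prod>x\<in>{x::complex. x ^ n = 1}. [:- x, 1:])"
proof -
  let ?p = "Polynomial.monom 1 n - 1 :: complex poly"
  have deg: "degree ?p = n"
    using assms degree_add_eq_left[of "- 1" "Polynomial.monom 1 n :: complex poly"]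
    by (simp add: degree_monom_eq)
  have "rsquarefree ?p"
    unfolding rsquarefree_roots using assms
    by (auto simp: poly_monom pderiv_diff pderiv_monom power_0_left)
  moreover have "lead_coeff ?p = 1"
    using assms unfolding deg by (simp add: coeff_1)
  moreover have "{x. poly ?p x = 0} = {x. x ^ n = 1}"
    by (simp add: poly_monom)
  ultimately show ?thesis
    using complex_poly_decompose_rsquarefree[of ?p] by simp
qed

text \<open>By strong induction, the product over the proper divisors of n divides x^n - 1 over the
  integers. The cofactor has the required complex factorization.\<close>

lemma ex_cyclotomic:
  assumes "n > 0"
  shows "\<exists>p. cpoly p = (\<Prod>x\<in>primitive_roots n. [:- x, 1:])"
  using assms
proof (induction n rule: less_induct)
  case (less n)
  define D where "D = {d. d dvd n \<and> d < n}"
  define U where "U = (\<Union>d\<in>D. primitive_roots d)"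
  have D: "finite D" "d > 0" "d < n" if "d \<in> D" for d
    using that less.prems by (auto simp: D_def intro: dvd_pos_nat)
  have "finite D" by (simp add: D_def)
  have "\<exists>p. cpoly p = (\<Prod>x\<in>primitive_roots d. [:- x, 1:])" if "d \<in> D" for d
    using less.IH D[OF that] by blast
  then obtain P where P: "\<And>d. d \<in> D \<Longrightarrow> cpoly (P d) = (\<Prod>x\<in>primitive_roots d. [:- x, 1:])"
    by metis
  have "finite U"
    using D \<open>finite D\<close> by (auto simp: U_def finite_primitive_roots)
  have A: "cpoly (\<Prod>d\<in>D. P d) = (\<Prod>x\<in>U. [:- x, 1:])"
  proof -
    have "cpoly (\<Prod>d\<in>D. P d) = (\<Prod>d\<in>D. \<Prod>x\<in>primitive_roots d. [:- x, 1:])"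
      using P by simp
    also have "\<dots> = (\<Prod>x\<in>U. [:- x, 1:])"
      unfolding U_def
    proof (rule prod.UNION_disjoint[symmetric])
      show "\<forall>d\<in>D. \<forall>e\<in>D. d \<noteq> e \<longrightarrow> primitive_roots d \<inter> primitive_roots e = {}"
        using D(2) primitive_roots_disjoint by blast
    qed (use D(2) \<open>finite D\<close> finite_primitive_roots in auto)
    finally show ?thesis .
  qed
  have "{d. d dvd n} = insert n D"
    using less.prems by (auto simp: D_def dest: dvd_imp_le)
  then have roots: "{x::complex. x ^ n = 1} = U \<union> primitive_roots n"
    using roots_unity_eq_Union[OF less.prems] by (auto simp: U_def)
  have disj: "U \<inter> primitive_roots n = {}"
  proof -
    have "primitive_roots d \<inter> primitive_roots n = {}" if "d \<in> D" for d
      using D[OF that] less.prems by (intro primitive_roots_disjoint) auto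
    then show ?thesis by (auto simp: U_def)
  qed
  have "(\<Prod>d\<in>D. P d) dvd Polynomial.monom 1 n - 1"
  proof (rule dvd_if_vanishes_on_roots[OF A \<open>finite U\<close>])
    fix x assume "x \<in> U"
    then have "x ^ n = 1" using roots by auto
    then show "poly (cpoly (Polynomial.monom 1 n - 1)) x = 0"
      by (simp add: poly_monom)
  qed
  then obtain B where B: "Polynomial.monom 1 n - 1 = (\<Prod>d\<in>D. P d) * B" by (elim dvdE)
  \<comment> \<open>Both sides are x^n - 1 over the complex numbers; cancelling the factor over
    \<open>U\<close> identifies \<open>cpoly B\<close>.\<close>
  have "(\<Prod>x\<in>U. [:- x, 1:]) * cpoly B = cpoly (Polynomial.monom 1 n - 1)"
    unfolding B cpoly_mult A ..
  also have "\<dots> = (\<Prod>x\<in>U. [:- x, 1:]) * (\<Prod>x\<in>primitive_roots n. [:- x, 1:])"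
    using \<open>finite U\<close> less.prems disj finite_primitive_roots
    by (simp add: monom_minus_1_eq_prod roots prod.union_disjoint)
  finally show ?case
    using \<open>finite U\<close> by (intro exI[of _ B]) simp
qed

text \<open>Existence comes from \<open>ex_cyclotomic\<close>; injectivity of \<open>cpoly\<close>
  gives the uniqueness that the definite description requires.\<close>

lemma cpoly_cyclotomic:
  assumes "n > 0"
  shows "cpoly (cyclotomic n) = (\<Prod>x\<in>primitive_roots n. [:- x, 1:])"
proof -
  have eq: "(\<Prod>k\<in>{k. k < n \<and> coprime k n}. [:- cis (2 * pi * real k / real n), 1:])
      = (\<Prod>x\<in>primitive_roots n. [:- x, 1:])"
    by (rule prod.reindex_bij_betw[OF bij_betw_primitive_roots[OF assms]])
  obtain p where p: "cpoly p = (\<Prod>x\<in>primitive_roots n. [:- x, 1:])"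
    using ex_cyclotomic[OF assms] by blast
  have "cyclotomic n = p"
    unfolding cyclotomic_def eq p[symmetric] by simp
  then show ?thesis
    using p by simp
qed

text \<open>
  Testing at primitive roots replaces the irreducibility of cyclotomic polynomials here and below.
\<close>
lemma cyclotomic_dvd:
  assumes "n > 0" "\<And>x. x \<in> primitive_roots n \<Longrightarrow> poly (cpoly p) x = 0"
  shows "cyclotomic n dvd p"
  using dvd_if_vanishes_on_roots[OF cpoly_cyclotomic] finite_primitive_roots assms by blast

text \<open>A common divisor of positive degree would have a complex root, necessarily a primitive
  one. A constant common divisor is a unit because the cyclotomic polynomial is monic.\<close>

lemma coprime_cyclotomic:
  assumes "n > 0" "\<And>x. x \<in> primitive_roots n \<Longrightarrow> poly (cpoly p) x \<noteq> 0"
  shows "coprime p (cyclotomic n)"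
proof (rule coprimeI)
  fix g assume g: "g dvd p" "g dvd cyclotomic n"
  obtain h where h: "cyclotomic n = g * h" using g by (elim dvdE)
  have "lead_coeff g dvd 1"
    using cpoly_linear_factors(1)[OF cpoly_cyclotomic[OF \<open>n > 0\<close>]]
    by (metis h lead_coeff_mult dvd_triv_left)
  have "degree g = 0"
  proof (rule ccontr)
    assume "degree g \<noteq> 0"
    then have "\<not> constant (poly (cpoly g))"
      by (simp add: constant_degree)
    then obtain x where x: "poly (cpoly g) x = 0"
      using fundamental_theorem_of_algebra by blast
    then have "poly (cpoly (cyclotomic n)) x = 0"
      by (simp add: h)
    then have "x \<in> primitive_roots n"
      using finite_primitive_roots[OF \<open>n > 0\<close>] by (auto simp: cpoly_cyclotomic[OF \<open>n > 0\<close>] poly_prod)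
    moreover have "poly (cpoly p) x = 0"
      using x g(1) by (auto elim!: dvdE)
    ultimately show False
      using assms(2) by blast
  qed
  then obtain c where "g = [:c:]"
    by (rule degree_eq_zeroE)
  then show "is_unit g"
    using \<open>lead_coeff g dvd 1\<close> by (simp add: is_unit_const_poly_iff)
qed

subsection \<open>Localization at the cyclotomic polynomial\<close>

definition cyclotomic_local_ring :: "nat \<Rightarrow> int poly fract set" where
  "cyclotomic_local_ring n
    = {to_fract P / to_fract Q | P Q. Q \<noteq> 0 \<and> coprime Q (cyclotomic n)}"

lemma cyclotomic_local_ringE:
  assumes "x \<in> cyclotomic_local_ring n"
  obtains P Q where "Q \<noteq> 0" "coprime Q (cyclotomic n)" "x = to_fract P / to_fract Q"
  using assms by (auto simp: cyclotomic_local_ring_def)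

lemma cyclotomic_local_ringI:
  "Q \<noteq> 0 \<Longrightarrow> coprime Q (cyclotomic n) \<Longrightarrow> x = to_fract P / to_fract Q \<Longrightarrow> x \<in> cyclotomic_local_ring n"
  by (auto simp: cyclotomic_local_ring_def)

lemma to_fract_in_cyclotomic_local_ring [simp]: "to_fract P \<in> cyclotomic_local_ring n"
  by (rule cyclotomic_local_ringI[of 1 _ _ P]) auto

interpretation cyclotomic_local_ring: field_subring "cyclotomic_local_ring n" for n
proof
  show "1 \<in> cyclotomic_local_ring n"
    using to_fract_in_cyclotomic_local_ring[of 1] by simp
next
  fix x y assume "x \<in> cyclotomic_local_ring n" "y \<in> cyclotomic_local_ring n"
  then obtain P Q P' Q' where xy:
    "Q \<noteq> 0" "coprime Q (cyclotomic n)" "x = to_fract P / to_fract Q"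
    "Q' \<noteq> 0" "coprime Q' (cyclotomic n)" "y = to_fract P' / to_fract Q'"
    by (metis cyclotomic_local_ringE)
  show "x - y \<in> cyclotomic_local_ring n"
    using xy by (intro cyclotomic_local_ringI[of "Q * Q'" _ _ "P * Q' - P' * Q"]) (simp_all add: diff_frac_eq)
  show "x * y \<in> cyclotomic_local_ring n"
    using xy by (intro cyclotomic_local_ringI[of "Q * Q'" _ _ "P * P'"]) simp_all
qed

lemma to_fract_power: "to_fract (p ^ k) = to_fract p ^ k"
  by (induction k) simp_all

lemma qvar_power: "qvar ^ k = to_fract (Polynomial.monom 1 k)"
  by (simp add: qvar_def to_fract_power[symmetric] monom_altdef)

lemma to_fract_const_of_nat: "to_fract [:int k:] = of_nat k"
proof (induction k)
  case (Suc k)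
  have "[:int (Suc k):] = 1 + [:int k:]"
    by (simp add: one_pCons)
  then show ?case
    using Suc by (metis of_nat_Suc to_fract_1 to_fract_add)
qed simp

lemma primitive_roots_nonempty: "n > 0 \<Longrightarrow> primitive_roots n \<noteq> {}"
proof -
  assume n: "n > 0"
  then have "cis (2 * pi * real 1 / real n) \<in> primitive_roots n"
    by (simp only: primitive_roots_def mem_Collect_eq cis_root_power_eq_1_iff) (auto dest: nat_dvd_not_less)
  then show ?thesis by blast
qed

lemma unit_cyclotomic_local_ring:
  assumes "n > 0" "\<And>x. x \<in> primitive_roots n \<Longrightarrow> poly (cpoly p) x \<noteq> 0"
  shows "to_fract p \<noteq> 0" "inverse (to_fract p) \<in> cyclotomic_local_ring n"
proof -
  have "p \<noteq> 0"
    using assms primitive_roots_nonempty[of n] by auto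
  then show "to_fract p \<noteq> 0" "inverse (to_fract p) \<in> cyclotomic_local_ring n"
    using coprime_cyclotomic[OF assms] by (auto intro!: cyclotomic_local_ringI[of p _ _ 1] simp: divide_inverse)
qed

lemma qvar_nonzero: "qvar \<noteq> 0"
  by (simp add: qvar_def)

lemma inverse_qvar_power_in_cyclotomic_local_ring:
  "n > 0 \<Longrightarrow> inverse (qvar ^ k) \<in> cyclotomic_local_ring n"
  unfolding qvar_power by (rule unit_cyclotomic_local_ring)
    (auto simp: poly_monom primitive_roots_def power_0_left)

lemma peval_in_cyclotomic_local_ring:
  "z \<in> cyclotomic_local_ring n \<Longrightarrow> peval f z \<in> cyclotomic_local_ring n"
  unfolding peval_def poly_altdef
  by (intro cyclotomic_local_ring.sum_closed cyclotomic_local_ring.mult_closed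
      cyclotomic_local_ring.power_closed) (simp_all add: coeff_map_poly)

text \<open>At a primitive root x, 1 - x^k vanishes only if n divides k. This makes the denominators
  of the weights invertible.\<close>

lemma one_minus_qvar_power_unit:
  assumes "\<not> n dvd k" "n > 0"
  shows "qvar ^ k \<noteq> 1" "inverse (1 - qvar ^ k) \<in> cyclotomic_local_ring n"
proof -
  have *: "1 - qvar ^ k = to_fract (1 - Polynomial.monom 1 k)"
    by (simp add: qvar_power)
  have "poly (cpoly (1 - Polynomial.monom 1 k)) x \<noteq> 0" if "x \<in> primitive_roots n" for x
    using that assms by (auto simp: poly_monom primitive_root_power_eq_1_iff)
  from unit_cyclotomic_local_ring[OF assms(2) this] show
    "qvar ^ k \<noteq> 1" "inverse (1 - qvar ^ k) \<in> cyclotomic_local_ring n"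
    unfolding *[symmetric] by auto
qed

text \<open>Both parities of n are treated at once: \<open>p\<close> is the polynomial behind z,
  taken as q^n with e = 1 or as -q^(n/2) with e = 2.\<close>

lemma dual_congruence:
  fixes n d a e :: nat and r s m :: int and p :: "int poly"
  assumes n: "n > 0" and d: "d > 0" "coprime n d" and "a < n" and s: "int a * int d + r = int n * s"
    and p: "cyclotomic n dvd p - 1" "to_fract p \<noteq> 0" "inverse (to_fract p) \<in> cyclotomic_local_ring n"
    and pn: "to_fract p ^ e = qvar ^ n"
    and sgn: "(-1) ^ (n - 1 - a) * (qvar ^ d) powi (- int ((n - a) choose 2))
      = (-1) ^ a * (qvar ^ d) powi (- int (Suc a choose 2)) * to_fract p powi (- (m * int d))"
    and c: "c = (-1) ^ a * (qvar ^ d) powi (int (Suc a choose 2)) * to_fract p powi (m * s)"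
  shows "cong_Phi2 n
     (\<Sum>k<n. qpoch (qvar powi r) (qvar ^ d) k * qpoch (qvar powi (int d - r)) (qvar ^ d) k
               / (qpoch (qvar ^ d) (qvar ^ d) k)\<^sup>2 * peval (f k) (qvar ^ d))
     (c * (\<Sum>k<n. qpoch (qvar powi r) (qvar ^ d) k * qpoch (qvar powi (int d - r)) (qvar ^ d) k
               / (qpoch (qvar ^ d) (qvar ^ d) k)\<^sup>2 * ftilde f k (qvar ^ d)))"
proof -
  let ?R = "cyclotomic_local_ring n"
  define y where "y = qvar ^ d"
  define x where "x = qvar powi r"
  define z where "z = to_fract p"
  have y: "y \<in> ?R" "inverse y \<in> ?R" "y \<noteq> 0"
    unfolding y_def using qvar_nonzero inverse_qvar_power_in_cyclotomic_local_ring[OF n]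
    by (simp_all, simp add: qvar_power)
  have weight: "qpoch (qvar powi r) (qvar ^ d) k * qpoch (qvar powi (int d - r)) (qvar ^ d) k
      / (qpoch (qvar ^ d) (qvar ^ d) k)\<^sup>2 = dual_weight y x k" for k
    using qvar_nonzero by (simp add: dual_weight_def x_def y_def power_int_diff)
  have "\<exists>u\<in>?R. (\<Sum>k<n. dual_weight y x k * peval (f k) y)
     - (-1) ^ a * y powi (int (Suc a choose 2)) * z powi (m * s)
       * (\<Sum>k<n. dual_weight y x k * (\<Sum>j\<le>k. dual_kernel y k j * peval (f j) y)) = (z - 1)\<^sup>2 * u"
  proof (rule cyclotomic_local_ring.dual_sum_congruence[OF y _ _ _ _ _ _ \<open>a < n\<close>, of z d e m "\<lambda>k. peval (f k) y" x s])
    show "z \<in> ?R" "inverse z \<in> ?R" "z \<noteq> 0"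
      using p by (simp_all add: z_def)
    show "y ^ i \<noteq> 1 \<and> inverse (1 - y ^ i) \<in> ?R" if "1 \<le> i" "i < n" for i
    proof -
      \<comment> \<open>Coprimality of n and d enters here: 1 - q^(d i) is a unit for 1 <= i <
        n.\<close>
      have "\<not> n dvd d * i"
        using that d by (simp add: coprime_dvd_mult_right_iff nat_dvd_not_less)
      then show ?thesis
        unfolding y_def power_mult[symmetric] using one_minus_qvar_power_unit[OF _ n] by blast
    qed
    \<comment> \<open>A nonzero integer constant has no roots, so d is invertible in the local ring,
      as the interpolation demands.\<close>
    have "poly (cpoly [:int d:]) x \<noteq> 0" for x
      using d by (simp add: map_poly_pCons)
    from unit_cyclotomic_local_ring[OF n this]
    show "inverse (of_nat d) \<in> ?R" "(of_nat d :: int poly fract) \<noteq> 0"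
      unfolding to_fract_const_of_nat by auto
    show "y ^ n = z ^ (e * d)"
      by (simp add: y_def z_def power_mult pn) (simp add: mult.commute flip: power_mult)
    show "x = y powi (- int a) * z powi (int e * s)"
    proof -
      have "r = - (int d * int a) + int n * s"
        using s by (simp add: algebra_simps)
      then have "x = qvar powi (- (int d * int a)) * qvar powi (int n * s)"
        unfolding x_def using qvar_nonzero by (metis power_int_add)
      moreover have "z powi (int e * s) = qvar powi (int n * s)"
        by (simp add: power_int_mult z_def pn)
      moreover have "y powi (- int a) = qvar powi (- (int d * int a))"
        unfolding y_def by (metis mult_minus_right power_int_mult power_int_of_nat)
      ultimately show ?thesis by simp
    qed
    show "peval (f k) y \<in> ?R" for k
      using y(1) by (rule peval_in_cyclotomic_local_ring)
  qed (use sgn in \<open>simp add: y_def z_def\<close>)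
  then obtain u where u: "u \<in> ?R" "(\<Sum>k<n. dual_weight y x k * peval (f k) y)
     - c * (\<Sum>k<n. dual_weight y x k * ftilde f k y) = (z - 1)\<^sup>2 * u"
    unfolding ftilde_def dual_kernel_def[symmetric] c y_def[symmetric] z_def[symmetric] by blast
  \<comment> \<open>The factor (z - 1)^2 supplies the square of the cyclotomic polynomial.\<close>
  obtain v where "p - 1 = cyclotomic n * v"
    using p by (elim dvdE)
  then have "z - 1 = to_fract (cyclotomic n * v)"
    unfolding z_def by (metis to_fract_1 to_fract_diff)
  moreover obtain P Q where Q: "Q \<noteq> 0" "coprime Q (cyclotomic n)" and "u = to_fract P / to_fract Q"
    using u(1) by (rule cyclotomic_local_ringE)
  ultimately have "(z - 1)\<^sup>2 * u = to_fract ((cyclotomic n)\<^sup>2 * (v\<^sup>2 * P)) / to_fract Q"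
    by (simp add: to_fract_power power_mult_distrib)
  with Q show ?thesis
    unfolding cong_Phi2_def weight unfolding y_def[symmetric] u(2) by blast
qed

theorem theorem1p2:
  fixes n d a :: nat and r :: int and f :: "nat \<Rightarrow> int poly"
  assumes "n \<ge> 2" and "d \<ge> 1" and "coprime n d"
    and "a < n" and "[int a * int d = - r] (mod int n)"
  shows
   "(odd n \<longrightarrow>
      cong_Phi2 n
        (\<Sum>k<n. qpoch (qvar powi r) (qvar ^ d) k * qpoch (qvar powi (int d - r)) (qvar ^ d) k
                  / (qpoch (qvar ^ d) (qvar ^ d) k)\<^sup>2 * peval (f k) (qvar ^ d))
        ((-1) ^ a * qvar powi (int d * int ((a + 1) choose 2)
                               + ((int a * int d + r) * (int n - 1 - 2 * int a)) div 2)
         * (\<Sum>k<n. qpoch (qvar powi r) (qvar ^ d) k * qpoch (qvar powi (int d - r)) (qvar ^ d) k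
                  / (qpoch (qvar ^ d) (qvar ^ d) k)\<^sup>2 * ftilde f k (qvar ^ d)))) \<and>
    (even n \<longrightarrow>
      cong_Phi2 n
        (\<Sum>k<n. qpoch (qvar powi r) (qvar ^ d) k * qpoch (qvar powi (int d - r)) (qvar ^ d) k
                  / (qpoch (qvar ^ d) (qvar ^ d) k)\<^sup>2 * peval (f k) (qvar ^ d))
        ((-1) powi (int a + (int a * int d + r) div int n)
         * qvar powi (int d * int ((a + 1) choose 2)
                      + ((int a * int d + r) * (int n - 1 - 2 * int a)) div 2)
         * (\<Sum>k<n. qpoch (qvar powi r) (qvar ^ d) k * qpoch (qvar powi (int d - r)) (qvar ^ d) k
                  / (qpoch (qvar ^ d) (qvar ^ d) k)\<^sup>2 * ftilde f k (qvar ^ d))))"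
proof -
  have n: "n > 0" and d: "d > 0"
    using assms by auto
  have "int n dvd int a * int d + r"
    using assms(5) by (simp add: cong_iff_dvd_diff)
  then obtain s where s: "int a * int d + r = int n * s"
    by (elim dvdE)
  have y_powi: "(qvar ^ d) powi k = qvar powi (int d * k)" for k
    by (simp add: power_int_mult)
  \<comment> \<open>The two eigenvalue exponents differ by n (n - 1 - 2a) / 2, the source of the
    second summand in the exponent of the theorem. Doubling avoids the parity question.\<close>
  have choose: "2 * int ((n - a) choose 2) = 2 * int (Suc a choose 2) + int n * (int n - 1 - 2 * int a)"
    unfolding double_int_choose_2 using \<open>a < n\<close> by (simp add: of_nat_diff algebra_simps)
  show ?thesis
  proof (intro conjI impI)
    assume "odd n"
    \<comment> \<open>For odd n the number n - 1 - 2a is even, so the quotient of the eigenvalues is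
      an integral power of z = q^n, and their signs agree.\<close>
    define m where "m = (int n - 1 - 2 * int a) div 2"
    have m: "int n - 1 - 2 * int a = 2 * m"
      using \<open>odd n\<close> by (simp add: m_def)
    have ch: "int ((n - a) choose 2) = int (Suc a choose 2) + int n * m"
      using choose unfolding m by simp
    have z: "to_fract (Polynomial.monom 1 n) powi k = qvar powi (int n * k)" for k
      by (simp add: power_int_mult qvar_power)
    show "cong_Phi2 n
        (\<Sum>k<n. qpoch (qvar powi r) (qvar ^ d) k * qpoch (qvar powi (int d - r)) (qvar ^ d) k
                  / (qpoch (qvar ^ d) (qvar ^ d) k)\<^sup>2 * peval (f k) (qvar ^ d))
        ((-1) ^ a * qvar powi (int d * int ((a + 1) choose 2)
                               + ((int a * int d + r) * (int n - 1 - 2 * int a)) div 2)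
         * (\<Sum>k<n. qpoch (qvar powi r) (qvar ^ d) k * qpoch (qvar powi (int d - r)) (qvar ^ d) k
                  / (qpoch (qvar ^ d) (qvar ^ d) k)\<^sup>2 * ftilde f k (qvar ^ d)))"
    proof (rule dual_congruence[OF n d assms(3,4) s, of "Polynomial.monom 1 n" 1 m])
      show "cyclotomic n dvd Polynomial.monom 1 n - 1"
        by (rule cyclotomic_dvd[OF n]) (auto simp: poly_monom primitive_roots_def)
      show "to_fract (Polynomial.monom 1 n :: int poly) \<noteq> 0"
        by (simp add: qvar_power[symmetric] qvar_nonzero del: to_fract_eq_0_iff)
      show "inverse (to_fract (Polynomial.monom 1 n)) \<in> cyclotomic_local_ring n"
        using inverse_qvar_power_in_cyclotomic_local_ring[OF n] by (simp flip: qvar_power)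
      show "to_fract (Polynomial.monom 1 n) ^ 1 = qvar ^ n"
        by (simp add: qvar_power)
      have "(-1 :: int poly fract) ^ (n - 1 - a) = (-1) ^ a"
        using \<open>odd n\<close> \<open>a < n\<close> by (simp add: uminus_power_if)
      moreover have "int d * - int ((n - a) choose 2)
          = int d * - int (Suc a choose 2) + int n * (- (m * int d))"
        unfolding ch by (simp add: algebra_simps)
      ultimately show "(-1) ^ (n - 1 - a) * (qvar ^ d) powi (- int ((n - a) choose 2))
        = (-1) ^ a * (qvar ^ d) powi (- int (Suc a choose 2))
          * to_fract (Polynomial.monom 1 n) powi (- (m * int d))"
        unfolding y_powi z using qvar_nonzero by (simp only: power_int_add mult.assoc simp_thms)
      have "(int a * int d + r) * (int n - 1 - 2 * int a) div 2 = int n * (m * s)"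
        unfolding s m by simp
      then show "(-1) ^ a * qvar powi (int d * int ((a + 1) choose 2)
            + ((int a * int d + r) * (int n - 1 - 2 * int a)) div 2)
        = (-1) ^ a * (qvar ^ d) powi (int (Suc a choose 2))
          * to_fract (Polynomial.monom 1 n) powi (m * s)"
        unfolding y_powi z using qvar_nonzero by (simp add: power_int_add)
    qed
  next
    assume "even n"
    \<comment> \<open>Here z = - q^h is congruent to 1 although q^h is congruent to -1; its odd powers produce the
      additional sign.\<close>
    then obtain h where h: "n = 2 * h" by (elim evenE)
    have "odd d"
      using \<open>coprime n d\<close> \<open>even n\<close> by (metis coprime_common_divisor odd_one)
    \<comment> \<open>Not halved this time: the factor 1/2 is absorbed by h = n/2. As m d is odd,
      z^(-m d) also carries the sign -1 by which the two eigenvalues differ.\<close>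
    define m where "m = int n - 1 - 2 * int a"
    have "odd m"
      using \<open>even n\<close> by (simp add: m_def)
    have ch: "int ((n - a) choose 2) = int (Suc a choose 2) + int h * m"
      using choose h unfolding m_def[symmetric] by simp
    have z: "to_fract (- Polynomial.monom 1 h) powi k
        = (if even k then 1 else - 1) * qvar powi (int h * k)" for k
      by (simp add: power_int_mult qvar_power power_int_minus_left)
    show "cong_Phi2 n
        (\<Sum>k<n. qpoch (qvar powi r) (qvar ^ d) k * qpoch (qvar powi (int d - r)) (qvar ^ d) k
                  / (qpoch (qvar ^ d) (qvar ^ d) k)\<^sup>2 * peval (f k) (qvar ^ d))
        ((-1) powi (int a + (int a * int d + r) div int n)
         * qvar powi (int d * int ((a + 1) choose 2)
                      + ((int a * int d + r) * (int n - 1 - 2 * int a)) div 2)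
         * (\<Sum>k<n. qpoch (qvar powi r) (qvar ^ d) k * qpoch (qvar powi (int d - r)) (qvar ^ d) k
                  / (qpoch (qvar ^ d) (qvar ^ d) k)\<^sup>2 * ftilde f k (qvar ^ d)))"
    proof (rule dual_congruence[OF n d assms(3,4) s, of "- Polynomial.monom 1 h" 2 m])
      show "cyclotomic n dvd - Polynomial.monom 1 h - 1"
      proof (rule cyclotomic_dvd[OF n])
        fix x assume x: "x \<in> primitive_roots n"
        \<comment> \<open>Here 0 < h < n, so x^h is a square root of 1 other than 1.\<close>
        then have "(x ^ h)\<^sup>2 = 1" "x ^ h \<noteq> 1"
          using n by (auto simp: primitive_roots_def h mult.commute simp flip: power_mult)
        then have "x ^ h = - 1"
          by (simp add: power2_eq_1_iff)
        then show "poly (cpoly (- Polynomial.monom 1 h - 1)) x = 0"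
          using cpoly_diff[of 0 "Polynomial.monom 1 h"] by (simp add: poly_monom)
      qed
      show "to_fract (- Polynomial.monom 1 h :: int poly) \<noteq> 0"
        by (simp add: qvar_power[symmetric] qvar_nonzero del: to_fract_eq_0_iff)
      show "inverse (to_fract (- Polynomial.monom 1 h)) \<in> cyclotomic_local_ring n"
        using inverse_qvar_power_in_cyclotomic_local_ring[OF n] by (simp flip: qvar_power)
      show "to_fract (- Polynomial.monom 1 h) ^ 2 = qvar ^ n"
        by (simp add: qvar_power[symmetric] h mult.commute flip: power_mult)
      have "(-1 :: int poly fract) ^ (n - 1 - a) = - ((-1) ^ a)"
        using \<open>even n\<close> \<open>a < n\<close> by (simp add: uminus_power_if)
      moreover have "int d * - int ((n - a) choose 2)
          = int d * - int (Suc a choose 2) + int h * (- (m * int d))"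
        unfolding ch by (simp add: algebra_simps)
      then have "qvar powi (int d * - int ((n - a) choose 2))
          = qvar powi (int d * - int (Suc a choose 2)) * qvar powi (int h * (- (m * int d)))"
        using qvar_nonzero by (metis power_int_add)
      moreover have "odd (- (m * int d))"
        using \<open>odd m\<close> \<open>odd d\<close> by simp
      ultimately show "(-1) ^ (n - 1 - a) * (qvar ^ d) powi (- int ((n - a) choose 2))
        = (-1) ^ a * (qvar ^ d) powi (- int (Suc a choose 2))
          * to_fract (- Polynomial.monom 1 h) powi (- (m * int d))"
        unfolding y_powi z by simp
      have "(int a * int d + r) * (int n - 1 - 2 * int a) div 2 = int h * (m * s)"
        unfolding s m_def[symmetric] by (simp add: h)
      moreover have "(int a * int d + r) div int n = s"
        unfolding s using n by simp
      \<comment> \<open>Since m is odd, m s has the parity of s = (a d + r) / n, which yields the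
        additional sign in the statement.\<close>
      ultimately show "(-1) powi (int a + (int a * int d + r) div int n)
          * qvar powi (int d * int ((a + 1) choose 2)
            + ((int a * int d + r) * (int n - 1 - 2 * int a)) div 2)
        = (-1) ^ a * (qvar ^ d) powi (int (Suc a choose 2))
          * to_fract (- Polynomial.monom 1 h) powi (m * s)"
        unfolding y_powi z using qvar_nonzero \<open>odd m\<close> by (simp add: power_int_add power_int_minus_left)
    qed
  qed
qed

end
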